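(* $\mathrm{Aut}(KO_{1[(3^3,4,3,4)]})=\langle\alpha\rangle\cong\mathbb{Z}_2$, $\mathrm{Aut}(KO_{2[(3^3,4,3,4)]})=\langle\alpha_1,\alpha_2\rangle\cong\mathbb{Z}_2\times\mathbb{Z}_2$, $\mathrm{Aut}(KNO_{1[(3^3,4,3,4)]})=\langle\beta\rangle\cong\mathbb{Z}_2$, $\mathrm{Aut}(KNO_{2[(3^3,4,3,4)]})=\langle\beta_1,\beta_2\rangle\cong\mathbb{Z}_2\times\mathbb{Z}_2$, $\mathrm{Aut}(KNO_{3[(3^3,4,3,4)]})=\langle\gamma\rangle\cong\mathbb{Z}_4$, where $\alpha=(0,3)(1,9)(2,4)(5,8)(6,10)(7,11)$, $\alpha_1=(0,2)(1,3)(4,9)(5,11)(6,8)(7,10)$, $\alpha_2=(0,4)(2,9)(5,6)(7,10)(8,11)$, $\beta=(0,3)(1,9)(2,4)(5,8)(6,11)$, $\beta_1=(0,1)(3,9)(5,10)(6,11)(7,8)$, $\beta_2=(0,3)(1,9)(2,4)(5,8)(7,10)$ and $\gamma=(0,1,10,6)(2,11,5,7)(3,4,8,9)$.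
   Context: A map is a finite (combinatorial) polyhedral 2-complex whose geometric carrier is a compact connected 2-manifold without boundary; its 2-faces are polygons identified with cycles of distinct vertices. An automorphism of a map is a permutation of its vertex set carrying faces (as cycles) onto faces; $\mathrm{Aut}(X)$ is the group of all automorphisms of $X$ under composition. Permutations are written in disjoint cycle notation, omitted vertices being fixed. The following maps have vertex set $\{0,1,\dots,11\}$; $[a,b,c]$ is a triangle and $[a,b,c,d]$ is the quadrilateral with boundary cycle $a\,b\,c\,d\,a$. $KO_{1[(3^3,4,3,4)]}$ has faces: $[0,4,5,6]$, $[0,1,8,7]$, $[1,11,10,4]$, $[2,3,10,8]$, $[2,6,7,9]$, $[9,5,11,3]$, $[0,1,2]$, $[0,2,3]$, $[0,3,4]$, $[0,6,7]$, $[1,8,11]$, $[4,5,10]$, $[1,2,9]$, $[1,4,9]$, $[7,8,10]$, $[2,6,8]$, $[5,7,10]$, $[5,7,9]$, $[3,10,11]$, $[3,4,9]$, $[6,8,11]$, $[5,6,11]$. $KO_{2[(3^3,4,3,4)]}$ has faces: $[0,4,5,6]$, $[0,1,8,7]$, $[1,11,10,4]$, $[2,3,6,10]$, $[2,8,11,9]$, $[9,7,5,3]$, $[0,1,2]$, $[0,2,3]$, $[0,3,4]$, $[0,6,7]$, $[1,8,11]$, $[4,5,10]$, $[1,2,9]$, $[1,4,9]$, $[2,8,10]$, $[7,9,11]$, $[3,5,6]$, $[3,4,9]$, $[5,8,10]$, $[5,7,8]$, $[6,10,11]$, $[6,7,11]$. $KNO_{1[(3^3,4,3,4)]}$ has faces: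 $[0,4,5,6]$, $[0,1,8,7]$, $[1,11,10,4]$, $[2,3,11,8]$, $[2,10,6,9]$, $[9,5,7,3]$, $[0,1,2]$, $[0,2,3]$, $[0,3,4]$, $[0,6,7]$, $[1,8,11]$, $[4,5,10]$, $[1,2,9]$, $[1,4,9]$, $[2,8,10]$, $[5,8,10]$, $[5,6,9]$, $[5,7,8]$, $[3,7,11]$, $[3,4,9]$, $[6,10,11]$, $[6,7,11]$. $KNO_{2[(3^3,4,3,4)]}$ has faces: $[0,4,5,6]$, $[0,1,8,7]$, $[1,11,10,4]$, $[2,3,6,8]$, $[2,7,11,9]$, $[9,5,10,3]$, $[0,1,2]$, $[0,2,3]$, $[0,3,4]$, $[0,6,7]$, $[1,8,11]$, $[4,5,10]$, $[1,2,9]$, $[1,4,9]$, $[5,6,8]$, $[2,7,8]$, $[5,8,11]$, $[5,9,11]$, $[3,6,10]$, $[3,4,9]$, $[7,10,11]$, $[6,7,10]$. $KNO_{3[(3^3,4,3,4)]}$ has faces: $[0,4,5,6]$, $[0,1,8,7]$, $[1,2,9,10]$, $[3,4,8,9]$, $[2,11,5,7]$, $[3,11,10,6]$, $[0,1,2]$, $[0,2,3]$, $[0,3,4]$, $[0,6,7]$, $[1,4,11]$, $[1,4,8]$, $[1,10,11]$, $[4,5,11]$, $[2,3,11]$, $[3,6,9]$, $[2,7,9]$, $[6,7,9]$, $[8,9,10]$, $[5,8,10]$, $[5,6,10]$, $[5,7,8]$. *)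

theory Defs
  imports "HOL-Algebra.Elementary_Groups" "HOL-Combinatorics.Cycles"
begin

text \<open>
  A face is the polygon bounded by a cycle of vertices. The cycle through the list
  \<open>vs\<close> has neither a base point nor an orientation, so it is represented by the set of all
  vertex lists that traverse it.
\<close>

definition polygon :: "'a list \<Rightarrow> 'a list set" where
  "polygon vs = {rotate k vs | k. True} \<union> {rotate k (rev vs) | k. True}"

record 'a polygonal_complex =
  vertices :: "'a set"
  faces :: "'a list set set"

definition automorphism :: "'a polygonal_complex \<Rightarrow> ('a \<Rightarrow> 'a) \<Rightarrow> bool" where
  "automorphism X p \<longleftrightarrow> p permutes vertices X \<and> (\<lambda>F. map p ` F) ` faces X = faces X"

definition Aut :: "'a polygonal_complex \<Rightarrow> ('a \<Rightarrow> 'a) monoid" where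
  "Aut X = \<lparr>carrier = {p. automorphism X p}, monoid.mult = (\<circ>), one = id\<rparr>"

lemma map_polygon: "map p ` polygon vs = polygon (map p vs)"
  by (auto simp: polygon_def image_Un rotate_map rev_map image_iff)

lemma automorphism_id: "automorphism X id"
  by (simp add: automorphism_def permutes_id)

lemma automorphism_comp:
  assumes "automorphism X p" "automorphism X q"
  shows "automorphism X (p \<circ> q)"
proof -
  have "(\<lambda>F. map (p \<circ> q) ` F) ` faces X = (\<lambda>F. map p ` F) ` (\<lambda>F. map q ` F) ` faces X"
    by (simp add: image_image)
  with assms show ?thesis
    by (simp add: automorphism_def permutes_compose)
qed

lemma automorphism_inv:
  assumes "automorphism X p"
  shows "automorphism X (Hilbert_Choice.inv p)"
proof -
  have p: "p permutes vertices X" and im: "(\<lambda>F. map p ` F) ` faces X = faces X"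
    using assms by (auto simp: automorphism_def)
  have "(\<lambda>F. map (Hilbert_Choice.inv p) ` F) ` faces X
      = (\<lambda>F. map (Hilbert_Choice.inv p) ` F) ` (\<lambda>F. map p ` F) ` faces X"
    by (simp add: im)
  also have "\<dots> = faces X"
    by (simp add: image_image permutes_inv_o(2)[OF p])
  finally show ?thesis
    using p by (simp add: automorphism_def permutes_inv)
qed

lemma group_Aut: "group (Aut X)"
proof (rule groupI)
  fix p assume "p \<in> carrier (Aut X)"
  then have "automorphism X p" by (simp add: Aut_def)
  then have "Hilbert_Choice.inv p \<in> carrier (Aut X)"
    and "Hilbert_Choice.inv p \<otimes>\<^bsub>Aut X\<^esub> p = \<one>\<^bsub>Aut X\<^esub>"
    using automorphism_inv[of X p] permutes_inv_o(2)[of p "vertices X"]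
    by (simp_all add: Aut_def automorphism_def)
  then show "\<exists>q\<in>carrier (Aut X). q \<otimes>\<^bsub>Aut X\<^esub> p = \<one>\<^bsub>Aut X\<^esub>" by blast
qed (auto simp: Aut_def automorphism_id automorphism_comp comp_assoc)

definition KO1 :: "nat polygonal_complex" where
  "KO1 = \<lparr>vertices = {0..11}, faces = polygon ` {
    [0,4,5,6], [0,1,8,7], [1,11,10,4], [2,3,10,8], [2,6,7,9], [9,5,11,3],
    [0,1,2], [0,2,3], [0,3,4], [0,6,7], [1,8,11], [4,5,10], [1,2,9], [1,4,9],
    [7,8,10], [2,6,8], [5,7,10], [5,7,9], [3,10,11], [3,4,9], [6,8,11], [5,6,11]}\<rparr>"

definition KO2 :: "nat polygonal_complex" where
  "KO2 = \<lparr>vertices = {0..11}, faces = polygon ` {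
    [0,4,5,6], [0,1,8,7], [1,11,10,4], [2,3,6,10], [2,8,11,9], [9,7,5,3],
    [0,1,2], [0,2,3], [0,3,4], [0,6,7], [1,8,11], [4,5,10], [1,2,9], [1,4,9],
    [2,8,10], [7,9,11], [3,5,6], [3,4,9], [5,8,10], [5,7,8], [6,10,11], [6,7,11]}\<rparr>"

definition KNO1 :: "nat polygonal_complex" where
  "KNO1 = \<lparr>vertices = {0..11}, faces = polygon ` {
    [0,4,5,6], [0,1,8,7], [1,11,10,4], [2,3,11,8], [2,10,6,9], [9,5,7,3],
    [0,1,2], [0,2,3], [0,3,4], [0,6,7], [1,8,11], [4,5,10], [1,2,9], [1,4,9],
    [2,8,10], [5,8,10], [5,6,9], [5,7,8], [3,7,11], [3,4,9], [6,10,11], [6,7,11]}\<rparr>"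

definition KNO2 :: "nat polygonal_complex" where
  "KNO2 = \<lparr>vertices = {0..11}, faces = polygon ` {
    [0,4,5,6], [0,1,8,7], [1,11,10,4], [2,3,6,8], [2,7,11,9], [9,5,10,3],
    [0,1,2], [0,2,3], [0,3,4], [0,6,7], [1,8,11], [4,5,10], [1,2,9], [1,4,9],
    [5,6,8], [2,7,8], [5,8,11], [5,9,11], [3,6,10], [3,4,9], [7,10,11], [6,7,10]}\<rparr>"

definition KNO3 :: "nat polygonal_complex" where
  "KNO3 = \<lparr>vertices = {0..11}, faces = polygon ` {
    [0,4,5,6], [0,1,8,7], [1,2,9,10], [3,4,8,9], [2,11,5,7], [3,11,10,6],
    [0,1,2], [0,2,3], [0,3,4], [0,6,7], [1,4,11], [1,4,8], [1,10,11], [4,5,11],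
    [2,3,11], [3,6,9], [2,7,9], [6,7,9], [8,9,10], [5,8,10], [5,6,10], [5,7,8]}\<rparr>"

definition alpha :: "nat \<Rightarrow> nat" where
  "alpha =
    cycle_of_list [0,3] \<circ> cycle_of_list [1,9] \<circ> cycle_of_list [2,4] \<circ>
    cycle_of_list [5,8] \<circ> cycle_of_list [6,10] \<circ> cycle_of_list [7,11]"

definition alpha1 :: "nat \<Rightarrow> nat" where
  "alpha1 =
    cycle_of_list [0,2] \<circ> cycle_of_list [1,3] \<circ> cycle_of_list [4,9] \<circ>
    cycle_of_list [5,11] \<circ> cycle_of_list [6,8] \<circ> cycle_of_list [7,10]"

definition alpha2 :: "nat \<Rightarrow> nat" where
  "alpha2 =
    cycle_of_list [0,4] \<circ> cycle_of_list [2,9] \<circ> cycle_of_list [5,6] \<circ>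
    cycle_of_list [7,10] \<circ> cycle_of_list [8,11]"

definition beta :: "nat \<Rightarrow> nat" where
  "beta =
    cycle_of_list [0,3] \<circ> cycle_of_list [1,9] \<circ> cycle_of_list [2,4] \<circ>
    cycle_of_list [5,8] \<circ> cycle_of_list [6,11]"

definition beta1 :: "nat \<Rightarrow> nat" where
  "beta1 =
    cycle_of_list [0,1] \<circ> cycle_of_list [3,9] \<circ> cycle_of_list [5,10] \<circ>
    cycle_of_list [6,11] \<circ> cycle_of_list [7,8]"

definition beta2 :: "nat \<Rightarrow> nat" where
  "beta2 =
    cycle_of_list [0,3] \<circ> cycle_of_list [1,9] \<circ> cycle_of_list [2,4] \<circ>
    cycle_of_list [5,8] \<circ> cycle_of_list [7,10]"

definition gamma :: "nat \<Rightarrow> nat" where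
  "gamma =
    cycle_of_list [0,1,10,6] \<circ> cycle_of_list [2,11,5,7] \<circ> cycle_of_list [3,4,8,9]"

end

theory Submission
  imports Defs "HOL-Algebra.Multiplicative_Group" "HOL-Computational_Algebra.Primes"
begin

text \<open>
  An automorphism of a map is determined by very little. Once it is known how it places one
  face, the faces that share vertices with it are forced to go to compatible faces, and the
  choice propagates over the connected surface. The quadrilateral \<open>[0,4,5,6]\<close> can be
  placed in only 48 ways (six quadrilaterals, eight traversals each), so each automorphism group
  is found by following these 48 choices until they become contradictory or have fixed the image
  of every vertex.

  The search is carried out with partial maps given by their graphs. Adding a face
  (\<open>extensions\<close>) keeps every partial map that sends the face to a traversal of some
  face and stays a well-defined injection. Restrictions of automorphisms are never discarded
  (\<open>graph_survives_search\<close>), so the surviving partial maps bound the automorphism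
  group from above (\<open>carrier_Aut_subset\<close>). For the five maps the survivors are
  exactly the powers of \<open>\<alpha>\<close>, \<open>\<beta>\<close> or \<open>\<gamma>\<close>, respectively
  \<open>id\<close>, \<open>\<alpha>\<^sub>1\<close>, \<open>\<alpha>\<^sub>2\<close>, \<open>\<alpha>\<^sub>1 \<circ> \<alpha>\<^sub>2\<close> and the analogous list for
  \<open>\<beta>\<^sub>1, \<beta>\<^sub>2\<close>. Conversely the generators are automorphisms because they send each
  listed face to a traversal of a listed face (\<open>automorphismI\<close>).

  What remains is elementary group theory: a group generated by one element is the cyclic
  group of that element's order, and a group exhausted by \<open>1, a, b, ab\<close> with distinct
  involutions \<open>a\<close>, \<open>b\<close> is a Klein four-group.
\<close>

section \<open>Polygons as lists of traversals\<close>

text \<open>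
  The rotation index runs below \<open>length vs\<close>, except that the empty list still gets its
  single traversal.
\<close>

definition traversals :: "'a list \<Rightarrow> 'a list list" where
  "traversals vs =
    concat (map (\<lambda>k. [rotate k vs, rotate k (rev vs)]) [0..<Suc (length vs - 1)])"

lemma set_traversals: "set (traversals vs) = polygon vs"
proof -
  have rot: "(\<exists>k<Suc (length xs - 1). ys = rotate k xs) \<longleftrightarrow> (\<exists>k. ys = rotate k xs)"
    for xs ys :: "'a list"
  proof (cases "xs = []")
    case False
    then have "k mod length xs < Suc (length xs - 1)" for k
      by simp
    then show ?thesis
      by (metis rotate_conv_mod)
  qed auto
  have "ys \<in> set (traversals vs) \<longleftrightarrow> ys \<in> polygon vs" for ys
    using rot[of vs ys] rot[of "rev vs" ys]
    by (auto simp: traversals_def polygon_def simp del: upt_Suc)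
  then show ?thesis
    by blast
qed

lemma self_in_polygon: "vs \<in> polygon vs"
  unfolding polygon_def by (rule UnI1) (auto intro: exI[of _ 0])

lemma rotate_in_polygon:
  assumes "ws \<in> polygon vs"
  shows "rotate k ws \<in> polygon vs"
  using assms by (auto simp: polygon_def rotate_rotate)

lemma rev_in_polygon:
  assumes "ws \<in> polygon vs"
  shows "rev ws \<in> polygon vs"
proof -
  have "\<exists>j. rev (rotate k xs) = rotate j (rev xs)" for k and xs :: "'a list"
    by (metis rotate_rev rev_rev_ident)
  then show ?thesis
    using assms by (auto simp: polygon_def) (metis rev_rev_ident)+
qed

text \<open>
  Being a traversal of the same polygon is an equivalence relation, since rotations can be undone
  by rotations; so a polygon is recognised from any one of its traversals.
\<close>

lemma polygon_eqI:
  assumes "ws \<in> polygon vs"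
  shows "polygon ws = polygon vs"
proof
  show "polygon ws \<subseteq> polygon vs"
    using assms by (auto simp: polygon_def[of ws] intro: rotate_in_polygon rev_in_polygon)
  have unrotate: "\<exists>j. rotate j (rotate k xs) = xs" for k and xs :: "'a list"
  proof (cases "xs = []")
    case False
    \<comment> \<open>Completing to a multiple of the length undoes the rotation.\<close>
    then have "k \<le> length xs * k"
      by (cases xs) auto
    then have "rotate (length xs * k - k) (rotate k xs) = rotate (length xs * k) xs"
      by (simp add: rotate_rotate)
    then show ?thesis
      by (metis rotate_conv_mod mod_mult_self1_is_0 rotate0 id_apply)
  qed simp
  consider k where "ws = rotate k vs" | k where "ws = rotate k (rev vs)"
    using assms by (auto simp: polygon_def)
  then have "vs \<in> polygon ws"
  proof cases
    case 1
    then show ?thesis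
      using unrotate[of k vs] rotate_in_polygon[OF self_in_polygon] by metis
  next
    case 2
    then show ?thesis
      using unrotate[of k "rev vs"] rotate_in_polygon[OF self_in_polygon] rev_in_polygon
      by (metis rev_rev_ident)
  qed
  then show "polygon vs \<subseteq> polygon ws"
    by (auto simp: polygon_def[of vs] intro: rotate_in_polygon rev_in_polygon)
qed

text \<open>
  A vertex permutation acts injectively on polygons, so on finitely many faces it is enough that
  it sends faces to faces.
\<close>

lemma automorphismI:
  assumes "faces X = polygon ` set L"
    and "p permutes vertices X"
    and "\<forall>f\<in>set L. \<exists>g\<in>set L. map p f \<in> set (traversals g)"
  shows "automorphism X p"
proof -
  have "(\<lambda>F. map p ` F) ` faces X \<subseteq> faces X"
  proof
    fix F assume "F \<in> (\<lambda>F. map p ` F) ` faces X"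
    then obtain f where "f \<in> set L" "F = polygon (map p f)"
      using assms(1) by (auto simp: map_polygon)
    then show "F \<in> faces X"
      using assms(1,3) polygon_eqI by (metis image_eqI set_traversals)
  qed
  moreover have "inj_on (\<lambda>F. map p ` F) (faces X)"
    using assms(2) by (auto intro!: inj_onI simp: inj_image_eq_iff permutes_inj)
  moreover have "finite (faces X)"
    using assms(1) by simp
  ultimately have "(\<lambda>F. map p ` F) ` faces X = faces X"
    by (simp add: endo_inj_surj)
  then show ?thesis
    using assms(2) by (simp add: automorphism_def)
qed

section \<open>Exhaustive search for automorphisms\<close>

text \<open>
  A partial map is the list of its (vertex, image) pairs. The condition
  \<open>v = x \<longleftrightarrow> w = y\<close> says at once that the two graphs give no vertex two
  images and no image two preimages. Traversals are generated face by face inside the loop, which keeps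
  the terms small when the search is evaluated by rewriting.
\<close>

definition extensions :: "'a list list \<Rightarrow> 'a list \<Rightarrow> ('a \<times> 'a) list list \<Rightarrow> ('a \<times> 'a) list list"
  where
  "extensions L f ms = concat (map (\<lambda>m. concat (map (\<lambda>g.
     if length g = length f
     then map (\<lambda>h. List.union (zip f h) m)
       (filter (\<lambda>h. \<forall>(v, w) \<in> set (zip f h). \<forall>(x, y) \<in> set m. v = x \<longleftrightarrow> w = y) (traversals g))
     else []) L)) ms)"

text \<open>
  An automorphism sends \<open>f\<close> to a traversal of a face, and this traversal is among those
  tried when \<open>f\<close> is added; injectivity of the automorphism makes it pass the filter.
\<close>

lemma graph_in_extensions:
  assumes X: "faces X = polygon ` set L" and p: "automorphism X p" and f: "f \<in> set L"
    and m: "m \<in> set ms" "\<forall>(v, w)\<in>set m. p v = w"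
  shows "\<exists>m'\<in>set (extensions L f ms). \<forall>(v, w)\<in>set m'. p v = w"
proof -
  have "polygon (map p f) \<in> faces X"
    using X p f by (metis automorphism_def image_eqI map_polygon)
  then obtain g where g: "g \<in> set L" "map p f \<in> set (traversals g)"
    using X self_in_polygon by (metis imageE set_traversals)
  have len: "length g = length f"
    using g(2) by (auto simp: set_traversals polygon_def dest: arg_cong[of _ _ length])
  have graph: "\<forall>(v, w)\<in>set (zip f (map p f)). p v = w"
    by (auto simp: zip_map2 zip_same_conv_map)
  have "inj p"
    using p by (auto simp: automorphism_def permutes_inj)
  then have "\<forall>(v, w)\<in>set (zip f (map p f)). \<forall>(x, y)\<in>set m. v = x \<longleftrightarrow> w = y"
    using graph m(2) by (fastforce dest: injD)
  then have "List.union (zip f (map p f)) m \<in> set (extensions L f ms)"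
    using m(1) g len unfolding extensions_def by (auto intro!: bexI)
  moreover have "\<forall>(v, w)\<in>set (List.union (zip f (map p f)) m). p v = w"
    using graph m(2) by auto
  ultimately show ?thesis
    by blast
qed

lemma graph_survives_search:
  assumes X: "faces X = polygon ` set L" and p: "automorphism X p" and fs: "set fs \<subseteq> set L"
    and ms: "\<exists>m\<in>set ms. \<forall>(v, w)\<in>set m. p v = w"
  shows "\<exists>m\<in>set (fold (extensions L) fs ms). \<forall>(v, w)\<in>set m. p v = w"
  using fs ms by (induction fs arbitrary: ms) (auto dest!: graph_in_extensions[OF X p])

text \<open>
  Only the faces in \<open>fs\<close> are placed, in this order: a few faces that reach all vertices
  suffice, and a good order discards wrong placements early.
\<close>

definition search_confirms ::
    "'a list list \<Rightarrow> 'a list \<Rightarrow> 'a list list \<Rightarrow> ('a \<Rightarrow> 'a) list \<Rightarrow> bool" where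
  "search_confirms L vs fs qs \<longleftrightarrow> (\<forall>m\<in>set (fold (extensions L) fs [[]]).
     \<exists>q\<in>set qs. \<forall>v\<in>set vs. (v, q v) \<in> set m)"

lemma permutes_eqI:
  assumes "p permutes A" "q permutes A" "\<forall>v\<in>A. p v = q v"
  shows "p = q"
  using assms by (metis ext permutes_not_in)

lemma carrier_Aut_subset:
  assumes "faces X = polygon ` set L" "vertices X = set vs" "set fs \<subseteq> set L"
    and qs: "\<forall>q\<in>set qs. automorphism X q"
    and "search_confirms L vs fs qs"
  shows "carrier (Aut X) \<subseteq> set qs"
proof
  fix p assume "p \<in> carrier (Aut X)"
  then have p: "automorphism X p"
    by (simp add: Aut_def)
  then obtain m where m: "m \<in> set (fold (extensions L) fs [[]])" "\<forall>(v, w)\<in>set m. p v = w"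
    using graph_survives_search[OF assms(1) p assms(3), of "[[]]"] by auto
  then obtain q where q: "q \<in> set qs" "\<forall>v\<in>set vs. (v, q v) \<in> set m"
    using assms(5) unfolding search_confirms_def by blast
  have "p = q"
    using p q qs m(2) assms(2) by (intro permutes_eqI[of p "set vs" q]) (auto simp: automorphism_def)
  with q show "p \<in> set qs"
    by simp
qed

section \<open>Cyclic groups and the Klein four-group\<close>

text \<open>
  The divisors of \<open>p ^ Suc k\<close> form a chain, and only the top one fails to divide
  \<open>p ^ k\<close>.
\<close>

lemma (in group) ord_eq_prime_power:
  assumes a: "a \<in> carrier G" and p: "prime p"
    and "a [^] (p ^ Suc k) = \<one>" "a [^] (p ^ k) \<noteq> \<one>"
  shows "ord a = p ^ Suc k"
proof -
  obtain i where i: "i \<le> Suc k" "ord a = p ^ i"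
    using assms(3) divides_primepow_nat[OF p, of "ord a" "Suc k"] pow_eq_id[OF a] by metis
  moreover have "\<not> i \<le> k"
    using assms(4) i(2) a le_imp_power_dvd by (auto simp: pow_eq_id)
  ultimately show ?thesis
    by (simp add: le_antisym not_less_eq_eq)
qed

text \<open>
  The isomorphism is \<open>k \<mapsto> a\<^sup>k\<close> on residues; exponents matter only modulo the order
  of \<open>a\<close>. For an element of infinite order this reads \<open>ord a = 0\<close> and
  \<open>integer_mod_group 0\<close> is the group of all integers.
\<close>

lemma (in group) iso_integer_mod_group_ord:
  assumes a: "a \<in> carrier G" and gen: "carrier G = generate G {a}"
  shows "G \<cong> integer_mod_group (ord a)"
proof -
  let ?Z = "integer_mod_group (ord a)"
  have red: "a [^] (k mod int (ord a)) = a [^] k" for k :: int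
    using a by (simp add: int_pow_eq minus_mod_eq_mult_div)
  have "(\<lambda>k::int. a [^] k) \<in> hom ?Z G"
    using a by (auto simp: hom_def red int_pow_mult)
  moreover have "inj_on (\<lambda>k::int. a [^] k) (carrier ?Z)"
  proof (rule inj_onI)
    fix j k assume "j \<in> carrier ?Z" "k \<in> carrier ?Z" "a [^] j = a [^] k"
    moreover from this(3) have "j mod int (ord a) = k mod int (ord a)"
      using a by (metis int_pow_eq mod_eq_dvd_iff)
    ultimately show "j = k"
      by (auto simp: carrier_integer_mod_group split: if_splits)
  qed
  moreover have "(\<lambda>k::int. a [^] k) ` carrier ?Z = carrier G"
  proof
    show "carrier G \<subseteq> (\<lambda>k::int. a [^] k) ` carrier ?Z"
    proof
      fix x assume "x \<in> carrier G"
      then obtain k :: int where "x = a [^] k"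
        using gen generate_pow[OF a] by auto
      then have "x = a [^] (k mod int (ord a))"
        by (simp add: red)
      moreover have "k mod int (ord a) \<in> carrier ?Z"
        by (auto simp: carrier_integer_mod_group)
      ultimately show "x \<in> (\<lambda>k::int. a [^] k) ` carrier ?Z"
        by blast
    qed
  qed (use a in auto)
  ultimately have "?Z \<cong> G"
    by (auto simp: is_iso_def iso_def bij_betw_def)
  then show ?thesis
    by (simp add: group.iso_sym)
qed

text \<open>
  Commutativity is automatic: by cancellation \<open>b \<otimes> a\<close> can be none of
  \<open>\<one>, a, b\<close>, which leaves \<open>a \<otimes> b\<close>. Then
  \<open>(i, j) \<mapsto> a\<^sup>i \<otimes> b\<^sup>j\<close> is an isomorphism from the direct product.
\<close>

lemma (in group) klein_four_group:
  assumes a: "a \<in> carrier G" and b: "b \<in> carrier G"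
    and aa: "a \<otimes> a = \<one>" and bb: "b \<otimes> b = \<one>"
    and neq: "a \<noteq> \<one>" "b \<noteq> \<one>" "a \<noteq> b"
    and sub: "carrier G \<subseteq> {\<one>, a, b, a \<otimes> b}"
  shows "carrier G = generate G {a, b} \<and> G \<cong> integer_mod_group 2 \<times>\<times> integer_mod_group 2"
proof
  have "\<one> \<in> generate G {a, b}" "a \<in> generate G {a, b}" "b \<in> generate G {a, b}"
    by (auto intro: generate.one generate.incl)
  then have "{\<one>, a, b, a \<otimes> b} \<subseteq> generate G {a, b}"
    by (auto intro: generate.eng)
  then show "carrier G = generate G {a, b}"
    using sub generate_incl[of "{a, b}"] a b by blast
  have inv: "inv a = a" "inv b = b"
    using a b aa bb by (auto intro: inv_equality)
  have "b \<otimes> a \<noteq> \<one>" "b \<otimes> a \<noteq> a" "b \<otimes> a \<noteq> b"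
    using a b neq inv inv_equality[of b a] by auto
  moreover have "b \<otimes> a \<in> {\<one>, a, b, a \<otimes> b}"
    using sub a b by auto
  ultimately have ba: "b \<otimes> a = a \<otimes> b"
    by blast
  have ab: "a \<otimes> b \<noteq> \<one>" 
    using a b neq(3) inv inv_equality[of a b] by auto
  define h where "h = (\<lambda>(i::int, j::int). (if i = 0 then \<one> else a) \<otimes> (if j = 0 then \<one> else b))"
  let ?Z = "integer_mod_group 2 \<times>\<times> integer_mod_group 2"
  have Z2: "carrier (integer_mod_group 2) = {0, 1}"
    by (auto simp: carrier_integer_mod_group)
  have "h \<in> hom ?Z G"
  proof (rule homI)
    fix x y assume "x \<in> carrier ?Z" "y \<in> carrier ?Z"
    moreover have "a \<otimes> (a \<otimes> b) = b" "a \<otimes> b \<otimes> b = a"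
      using a b aa bb by (metis m_assoc l_one, metis m_assoc r_one)
    moreover from this have "b \<otimes> (a \<otimes> b) = a" "a \<otimes> b \<otimes> a = b" "a \<otimes> b \<otimes> (a \<otimes> b) = \<one>"
      using a b aa bb ba by (metis m_assoc, metis m_assoc, metis m_assoc m_closed)
    ultimately show "h (x \<otimes>\<^bsub>?Z\<^esub> y) = h x \<otimes> h y"
      using a b aa bb ba by (auto simp: Z2 h_def)
  qed (use a b in \<open>auto simp: h_def\<close>)
  moreover have "bij_betw h (carrier ?Z) (carrier G)"
  proof -
    have Z: "carrier ?Z = {(0, 0), (1, 0), (0, 1), (1, 1)}"
      by (auto simp: Z2)
    have h: "h (0, 0) = \<one>" "h (1, 0) = a" "h (0, 1) = b" "h (1, 1) = a \<otimes> b"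
      using a b by (simp_all add: h_def)
    have "a \<otimes> b \<noteq> a" "a \<otimes> b \<noteq> b"
      using a b neq by auto
    then have "inj_on h (carrier ?Z)"
      unfolding Z inj_on_def ball_simps h using neq ab by metis
    moreover have "carrier G = {\<one>, a, b, a \<otimes> b}"
      using sub a b by blast
    then have "h ` carrier ?Z = carrier G"
      by (simp only: Z h image_insert image_empty)
    ultimately show ?thesis
      by (simp add: bij_betw_def)
  qed
  ultimately have "?Z \<cong> G"
    by (auto simp: is_iso_def iso_def)
  then show "G \<cong> ?Z"
    by (simp add: group.iso_sym DirProd_group)
qed

section \<open>From a successful search to the automorphism group\<close>

lemma automorphism_funpow:
  assumes "automorphism X p"
  shows "automorphism X (p ^^ n)"
proof (induction n)
  case 0
  show ?case
    using automorphism_id by (simp add: id_def)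
next
  case (Suc n)
  then show ?case
    using automorphism_comp[OF assms] by (simp add: comp_def)
qed

lemma Aut_pow: "a [^]\<^bsub>Aut X\<^esub> (n::nat) = a ^^ n"
proof (induction n)
  case (Suc n)
  then show ?case
    by (simp add: nat_pow_Suc Aut_def funpow_swap1 fun_eq_iff)
qed (simp add: Aut_def)

text \<open>
  The hypotheses on faces, on powers of \<open>a\<close> and on the search are finite computations
  for a concrete map. The search shows that all automorphisms are powers of \<open>a\<close>; the two conditions on powers of \<open>a\<close>
  fix its order.
\<close>

lemma Aut_cyclic:
  assumes X: "faces X = polygon ` set L" "vertices X = set vs"
    and a: "a permutes set vs" "\<forall>f\<in>set L. \<exists>g\<in>set L. map a f \<in> set (traversals g)"
    and n: "prime p" "n = p ^ Suc k"
    and ord: "\<forall>v\<in>set vs. (a ^^ n) v = v" "\<exists>v\<in>set vs. (a ^^ (p ^ k)) v \<noteq> v"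
    and search: "set fs \<subseteq> set L" "search_confirms L vs fs (map ((^^) a) [0..<n])"
  shows "carrier (Aut X) = generate (Aut X) {a} \<and> Aut X \<cong> integer_mod_group n"
proof -
  interpret G: group "Aut X"
    by (rule group_Aut)
  have aut: "automorphism X a"
    using X a by (simp add: automorphismI)
  then have car: "a \<in> carrier (Aut X)"
    by (simp add: Aut_def)
  have "carrier (Aut X) \<subseteq> set (map ((^^) a) [0..<n])"
    using X search aut by (intro carrier_Aut_subset) (auto simp: automorphism_funpow)
  moreover have "a ^^ i \<in> generate (Aut X) {a}" for i
    unfolding G.generate_pow[OF car] by (auto simp: int_pow_int Aut_pow intro!: exI[of _ "int i"])
  ultimately have gen: "carrier (Aut X) = generate (Aut X) {a}"
    using G.generate_incl[of "{a}"] car by auto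
  have "(a ^^ n) permutes set vs"
    using automorphism_funpow[OF aut] X(2) by (simp add: automorphism_def)
  then have "a ^^ n = id"
    using ord(1) by (intro permutes_eqI[of _ "set vs"]) (auto simp: permutes_id)
  moreover have "a ^^ (p ^ k) \<noteq> id"
    using ord(2) by auto
  ultimately have "G.ord a = n"
    using n car G.ord_eq_prime_power[of a p k] by (simp only: Aut_pow) (simp add: Aut_def)
  then show ?thesis
    using gen G.iso_integer_mod_group_ord[OF car gen] by simp
qed

lemma Aut_klein_four:
  assumes X: "faces X = polygon ` set L" "vertices X = set vs"
    and a: "a permutes set vs" "\<forall>f\<in>set L. \<exists>g\<in>set L. map a f \<in> set (traversals g)"
    and b: "b permutes set vs" "\<forall>f\<in>set L. \<exists>g\<in>set L. map b f \<in> set (traversals g)"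
    and inv: "\<forall>v\<in>set vs. a (a v) = v" "\<forall>v\<in>set vs. b (b v) = v"
    and neq: "\<exists>v\<in>set vs. a v \<noteq> v" "\<exists>v\<in>set vs. b v \<noteq> v" "\<exists>v\<in>set vs. a v \<noteq> b v"
    and search: "set fs \<subseteq> set L" "search_confirms L vs fs [id, a, b, a \<circ> b]"
  shows "carrier (Aut X) = generate (Aut X) {a, b} \<and>
    Aut X \<cong> integer_mod_group 2 \<times>\<times> integer_mod_group 2"
proof -
  interpret G: group "Aut X"
    by (rule group_Aut)
  have aut: "automorphism X a" "automorphism X b"
    using X a b by (simp_all add: automorphismI)
  have sub: "carrier (Aut X) \<subseteq> set [id, a, b, a \<circ> b]"
    using X search aut
    by (intro carrier_Aut_subset) (auto simp: automorphism_id automorphism_comp)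
  have "a \<circ> a = id" "b \<circ> b = id"
    using a(1) b(1) inv
    by (auto intro!: permutes_eqI[of _ "set vs"] simp: permutes_id permutes_compose)
  moreover have "a \<noteq> id" "b \<noteq> id" "a \<noteq> b"
    using neq by auto
  ultimately show ?thesis
    using sub aut by (intro G.klein_four_group) (auto simp: Aut_def)
qed

section \<open>The five maps\<close>

definition KO1_faces :: "nat list list" where
  "KO1_faces = [
    [0,4,5,6], [0,1,8,7], [1,11,10,4], [2,3,10,8], [2,6,7,9], [9,5,11,3],
    [0,1,2], [0,2,3], [0,3,4], [0,6,7], [1,8,11], [4,5,10], [1,2,9], [1,4,9],
    [7,8,10], [2,6,8], [5,7,10], [5,7,9], [3,10,11], [3,4,9], [6,8,11], [5,6,11]]"

definition KO2_faces :: "nat list list" where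
  "KO2_faces = [
    [0,4,5,6], [0,1,8,7], [1,11,10,4], [2,3,6,10], [2,8,11,9], [9,7,5,3],
    [0,1,2], [0,2,3], [0,3,4], [0,6,7], [1,8,11], [4,5,10], [1,2,9], [1,4,9],
    [2,8,10], [7,9,11], [3,5,6], [3,4,9], [5,8,10], [5,7,8], [6,10,11], [6,7,11]]"

definition KNO1_faces :: "nat list list" where
  "KNO1_faces = [
    [0,4,5,6], [0,1,8,7], [1,11,10,4], [2,3,11,8], [2,10,6,9], [9,5,7,3],
    [0,1,2], [0,2,3], [0,3,4], [0,6,7], [1,8,11], [4,5,10], [1,2,9], [1,4,9],
    [2,8,10], [5,8,10], [5,6,9], [5,7,8], [3,7,11], [3,4,9], [6,10,11], [6,7,11]]"

definition KNO2_faces :: "nat list list" where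
  "KNO2_faces = [
    [0,4,5,6], [0,1,8,7], [1,11,10,4], [2,3,6,8], [2,7,11,9], [9,5,10,3],
    [0,1,2], [0,2,3], [0,3,4], [0,6,7], [1,8,11], [4,5,10], [1,2,9], [1,4,9],
    [5,6,8], [2,7,8], [5,8,11], [5,9,11], [3,6,10], [3,4,9], [7,10,11], [6,7,10]]"

definition KNO3_faces :: "nat list list" where
  "KNO3_faces = [
    [0,4,5,6], [0,1,8,7], [1,2,9,10], [3,4,8,9], [2,11,5,7], [3,11,10,6],
    [0,1,2], [0,2,3], [0,3,4], [0,6,7], [1,4,11], [1,4,8], [1,10,11], [4,5,11],
    [2,3,11], [3,6,9], [2,7,9], [6,7,9], [8,9,10], [5,8,10], [5,6,10], [5,7,8]]"

lemma KO1_complex: "faces KO1 = polygon ` set KO1_faces" "vertices KO1 = set [0..<12]"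
  by (auto simp: KO1_def KO1_faces_def)

lemma KO2_complex: "faces KO2 = polygon ` set KO2_faces" "vertices KO2 = set [0..<12]"
  by (auto simp: KO2_def KO2_faces_def)

lemma KNO1_complex: "faces KNO1 = polygon ` set KNO1_faces" "vertices KNO1 = set [0..<12]"
  by (auto simp: KNO1_def KNO1_faces_def)

lemma KNO2_complex: "faces KNO2 = polygon ` set KNO2_faces" "vertices KNO2 = set [0..<12]"
  by (auto simp: KNO2_def KNO2_faces_def)

lemma KNO3_complex: "faces KNO3 = polygon ` set KNO3_faces" "vertices KNO3 = set [0..<12]"
  by (auto simp: KNO3_def KNO3_faces_def)

lemma alpha_permutes: "alpha permutes set [0..<12]"
  unfolding alpha_def by (intro permutes_compose permutes_subset[OF cycle_permutes]) auto

lemma alpha1_permutes: "alpha1 permutes set [0..<12]"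
  unfolding alpha1_def by (intro permutes_compose permutes_subset[OF cycle_permutes]) auto

lemma alpha2_permutes: "alpha2 permutes set [0..<12]"
  unfolding alpha2_def by (intro permutes_compose permutes_subset[OF cycle_permutes]) auto

lemma beta_permutes: "beta permutes set [0..<12]"
  unfolding beta_def by (intro permutes_compose permutes_subset[OF cycle_permutes]) auto

lemma beta1_permutes: "beta1 permutes set [0..<12]"
  unfolding beta1_def by (intro permutes_compose permutes_subset[OF cycle_permutes]) auto

lemma beta2_permutes: "beta2 permutes set [0..<12]"
  unfolding beta2_def by (intro permutes_compose permutes_subset[OF cycle_permutes]) auto

lemma gamma_permutes: "gamma permutes set [0..<12]"
  unfolding gamma_def by (intro permutes_compose permutes_subset[OF cycle_permutes]) auto

text \<open>
  Rewriting a product of transpositions at a symbolic vertex copies that vertex at every factor,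
  so products of the permutations below would become exponentially large. With tables of values
  as their code equations, evaluating such a product is a chain of lookups.
\<close>

definition table :: "nat list \<Rightarrow> nat \<Rightarrow> nat" where
  "table ws v = (if v < length ws then ws ! v else v)"

lemma eq_table:
  assumes "p permutes set [0..<n]" "map p [0..<n] = ws"
  shows "p v = table ws v"
  using assms by (auto simp: table_def permutes_not_in)

lemma alpha_table [code]: "alpha v = table [3,9,4,0,2,8,10,11,5,1,6,7] v"
  by (intro eq_table[OF alpha_permutes]) code_simp

lemma alpha1_table [code]: "alpha1 v = table [2,3,0,1,9,11,8,10,6,4,7,5] v"
  by (intro eq_table[OF alpha1_permutes]) code_simp

lemma alpha2_table [code]: "alpha2 v = table [4,1,9,3,0,6,5,10,11,2,7,8] v"
  by (intro eq_table[OF alpha2_permutes]) code_simp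

lemma beta_table [code]: "beta v = table [3,9,4,0,2,8,11,7,5,1,10,6] v"
  by (intro eq_table[OF beta_permutes]) code_simp

lemma beta1_table [code]: "beta1 v = table [1,0,2,9,4,10,11,8,7,3,5,6] v"
  by (intro eq_table[OF beta1_permutes]) code_simp

lemma beta2_table [code]: "beta2 v = table [3,9,4,0,2,8,6,10,5,1,7,11] v"
  by (intro eq_table[OF beta2_permutes]) code_simp

lemma gamma_table [code]: "gamma v = table [1,10,11,4,8,7,0,2,9,3,6,5] v"
  by (intro eq_table[OF gamma_permutes]) code_simp

text \<open>
  The face orders below were selected greedily. Each starts with a quadrilateral; every
  later face has at least two vertices in earlier faces, so it has few compatible placements, and
  together the faces contain all twelve vertices.
\<close>

lemma Aut_KO1:
  "carrier (Aut KO1) = generate (Aut KO1) {alpha} \<and> Aut KO1 \<cong> integer_mod_group 2"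
proof (rule Aut_cyclic[OF KO1_complex alpha_permutes, where p = 2 and k = 0])
  let ?fs = "[[0,4,5,6],[0,3,4],[9,5,11,3],[3,4,9],[0,2,3],[2,3,10,8],[1,11,10,4],[0,1,8,7]]"
  show "search_confirms KO1_faces [0..<12] ?fs (map ((^^) alpha) [0..<2])"
    by code_simp
qed code_simp+

lemma Aut_KO2:
  "carrier (Aut KO2) = generate (Aut KO2) {alpha1, alpha2} \<and>
    Aut KO2 \<cong> integer_mod_group 2 \<times>\<times> integer_mod_group 2"
proof (rule Aut_klein_four[OF KO2_complex alpha1_permutes _ alpha2_permutes])
  let ?fs = "[[0,4,5,6],[0,3,4],[3,5,6],[2,3,6,10],[1,11,10,4],[0,1,8,7],[2,8,11,9]]"
  show "search_confirms KO2_faces [0..<12] ?fs [id, alpha1, alpha2, alpha1 \<circ> alpha2]"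
    by code_simp
qed code_simp+

lemma Aut_KNO1:
  "carrier (Aut KNO1) = generate (Aut KNO1) {beta} \<and> Aut KNO1 \<cong> integer_mod_group 2"
proof (rule Aut_cyclic[OF KNO1_complex beta_permutes, where p = 2 and k = 0])
  let ?fs = "[[0,4,5,6],[0,3,4],[9,5,7,3],[0,1,8,7],[1,11,10,4],[2,3,11,8]]"
  show "search_confirms KNO1_faces [0..<12] ?fs (map ((^^) beta) [0..<2])"
    by code_simp
qed code_simp+

lemma Aut_KNO2:
  "carrier (Aut KNO2) = generate (Aut KNO2) {beta1, beta2} \<and>
    Aut KNO2 \<cong> integer_mod_group 2 \<times>\<times> integer_mod_group 2"
proof (rule Aut_klein_four[OF KNO2_complex beta1_permutes _ beta2_permutes])
  let ?fs = "[[0,4,5,6],[0,3,4],[2,3,6,8],[0,1,2],[1,11,10,4],[0,1,8,7],[2,7,11,9]]"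
  show "search_confirms KNO2_faces [0..<12] ?fs [id, beta1, beta2, beta1 \<circ> beta2]"
    by code_simp
qed code_simp+

lemma Aut_KNO3:
  "carrier (Aut KNO3) = generate (Aut KNO3) {gamma} \<and> Aut KNO3 \<cong> integer_mod_group 4"
proof (rule Aut_cyclic[OF KNO3_complex gamma_permutes, where p = 2 and k = 1])
  let ?fs = "[[0,4,5,6],[0,3,4],[3,11,10,6],[2,11,5,7],[0,1,8,7],[1,2,9,10]]"
  show "search_confirms KNO3_faces [0..<12] ?fs (map ((^^) gamma) [0..<4])"
    by code_simp
qed code_simp+

theorem lemma3:
  shows
    "(carrier (Aut KO1) = generate (Aut KO1) {alpha} \<and>
       Aut KO1 \<cong> integer_mod_group 2) \<and>
     (carrier (Aut KO2) = generate (Aut KO2) {alpha1, alpha2} \<and>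
       Aut KO2 \<cong> integer_mod_group 2 \<times>\<times> integer_mod_group 2) \<and>
     (carrier (Aut KNO1) = generate (Aut KNO1) {beta} \<and>
       Aut KNO1 \<cong> integer_mod_group 2) \<and>
     (carrier (Aut KNO2) = generate (Aut KNO2) {beta1, beta2} \<and>
       Aut KNO2 \<cong> integer_mod_group 2 \<times>\<times> integer_mod_group 2) \<and>
     (carrier (Aut KNO3) = generate (Aut KNO3) {gamma} \<and>
       Aut KNO3 \<cong> integer_mod_group 4)"
  using Aut_KO1 Aut_KO2 Aut_KNO1 Aut_KNO2 Aut_KNO3 by blast

end
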